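(* Let $\varphi_2$ be the monoid homomorphism $\mathcal{A}_2^{\star}\to UT_6(\mathbb{S})$ determined by $\varepsilon\mapsto \mathrm{E}_6$, \[ 1\mapsto \mathsf{diag}\{s,\mathrm{P},\mathrm{J},\mathbf{1}\},\qquad 2\mapsto \mathsf{diag}\{\mathbf{1},\mathrm{K},\mathrm{Q},s\}. \] Then $\varphi_2$ induces a map $\varphi_2:(\mathsf{baxt}_2,{}^{\sharp})\to (UT_6(\mathbb{S}),{}^{D})$ which is a faithful representation of the involution monoid $(\mathsf{baxt}_2,{}^{\sharp})$, i.e. an injective homomorphism of involution monoids.
   Context: Baxter monoid: for $n\ge 1$ let $\mathcal{A}_n=\{1<2<\cdots<n\}$ and let $\mathcal{A}_n^{\star}$ be the free monoid on $\mathcal{A}_n$ with empty word $\varepsilon$. Then $\mathsf{baxt}_n=\mathcal{A}_n^{\star}/\!\equiv$, where $\equiv$ is the congruence generated by all pairs $(c\mathbf{u}ad\mathbf{v}b,\ c\mathbf{u}da\mathbf{v}b)$ with $a\le b<c\le d$ and $(b\mathbf{u}da\mathbf{v}c,\ b\mathbf{u}ad\mathbf{v}c)$ with $a<b\le c<d$, where $a,b,c,d\in\mathcal{A}_n$, $\mathbf{u},\mathbf{v}\in\mathcal{A}_n^{\star}$. Schützenberger's involution $^{\sharp}$ on $\mathsf{baxt}_n$ is induced by $i^{\sharp}=n+1-i$ and $(w_1\cdots w_k)^{\sharp}=w_k^{\sharp}\cdots w_1^{\sharp}$ (this is compatible with $\equiv$). Semiring: $\mathbb{S}$ is a commutative idempotent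 semiring ($(S,+)$ and $(S,\cdot)$ are commutative monoids with identities $\mathbf{0}$ and $\mathbf{1}$ respectively, multiplication distributes over addition, $\mathbf{0}\cdot a=\mathbf{0}$, and $a+a=a$ for all $a$) containing an element $s$ of infinite multiplicative order, meaning that for non-negative integers $i,j$, $s^i=s^j$ iff $i=j$. Matrices: $UT_m(\mathbb{S})$ is the monoid of upper triangular $m\times m$ matrices over $\mathbb{S}$ under matrix multiplication; $^D$ is the skew transposition $(A^D)_{ij}=A_{(m+1-j)(m+1-i)}$, an involution on it. $\mathrm{E}_m$ is the $m\times m$ identity matrix, $\mathsf{diag}\{\cdots\}$ denotes a block diagonal matrix, and \[ \mathrm{P}=\begin{pmatrix} s&\mathbf{0}\\ \mathbf{0}&\mathbf{1}\end{pmatrix},\quad \mathrm{Q}=\begin{pmatrix} \mathbf{1}&\mathbf{0}\\ \mathbf{0}&s\end{pmatrix},\quad \mathrm{J}=\begin{pmatrix} \mathbf{1}&\mathbf{1}\\ \mathbf{0}&\mathbf{0}\end{pmatrix},\quad \mathrm{K}=\begin{pmatrix} \mathbf{0}&\mathbf{1}\\ \mathbf{0}&\mathbf{1}\end{pmatrix}. \] *)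

theory Defs
  imports "Jordan_Normal_Form.Matrix" "HOL-Algebra.Group"
begin

locale involution_monoid = monoid M for M (structure) +
  fixes star :: "'a \<Rightarrow> 'a"
  assumes star_closed: "x \<in> carrier M \<Longrightarrow> star x \<in> carrier M"
    and star_star: "x \<in> carrier M \<Longrightarrow> star (star x) = x"
    and star_mult: "\<lbrakk>x \<in> carrier M; y \<in> carrier M\<rbrakk> \<Longrightarrow> star (x \<otimes> y) = star y \<otimes> star x"

locale involution_monoid_hom =
  M: involution_monoid M starM + N: involution_monoid N starN
  for M (structure) and starM and N (structure) and starN +
  fixes h
  assumes hom: "h \<in> hom M N"
    and one: "h \<one>\<^bsub>M\<^esub> = \<one>\<^bsub>N\<^esub>"
    and star: "x \<in> carrier M \<Longrightarrow> h (starM x) = starN (h x)"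

text \<open>The letters of the alphabet with \<open>n\<close> letters are the natural numbers from 1 to \<open>n\<close>.\<close>

definition free_monoid :: "nat \<Rightarrow> nat list monoid" where
  "free_monoid n = \<lparr>carrier = lists {1..n}, mult = (@), one = []\<rparr>"

inductive_set baxt_relations :: "(nat list \<times> nat list) set" where
  "\<lbrakk>a \<le> b; b < c; c \<le> d\<rbrakk> \<Longrightarrow>
     ([c] @ u @ [a, d] @ v @ [b], [c] @ u @ [d, a] @ v @ [b]) \<in> baxt_relations"
| "\<lbrakk>a < b; b \<le> c; c < d\<rbrakk> \<Longrightarrow>
     ([b] @ u @ [d, a] @ v @ [c], [b] @ u @ [a, d] @ v @ [c]) \<in> baxt_relations"

text \<open>The smallest congruence on the words over the first \<open>n\<close> letters that contains all
  Baxter relations between such words.\<close>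

inductive_set baxt_cong :: "nat \<Rightarrow> (nat list \<times> nat list) set" for n where
  gen: "\<lbrakk>(x, y) \<in> baxt_relations; x \<in> lists {1..n}; y \<in> lists {1..n}\<rbrakk> \<Longrightarrow> (x, y) \<in> baxt_cong n"
| refl: "x \<in> lists {1..n} \<Longrightarrow> (x, x) \<in> baxt_cong n"
| sym: "(x, y) \<in> baxt_cong n \<Longrightarrow> (y, x) \<in> baxt_cong n"
| trans: "\<lbrakk>(x, y) \<in> baxt_cong n; (y, z) \<in> baxt_cong n\<rbrakk> \<Longrightarrow> (x, z) \<in> baxt_cong n"
| mult: "\<lbrakk>(x, x') \<in> baxt_cong n; (y, y') \<in> baxt_cong n\<rbrakk> \<Longrightarrow> (x @ y, x' @ y') \<in> baxt_cong n"

definition baxt_class :: "nat \<Rightarrow> nat list \<Rightarrow> nat list set" where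
  "baxt_class n w = baxt_cong n `` {w}"

definition baxt :: "nat \<Rightarrow> nat list set monoid" where
  "baxt n = \<lparr>carrier = lists {1..n} // baxt_cong n,
             mult = (\<lambda>X Y. \<Union>x\<in>X. \<Union>y\<in>Y. baxt_class n (x @ y)),
             one = baxt_class n []\<rparr>"

definition sharp_word :: "nat \<Rightarrow> nat list \<Rightarrow> nat list" where
  "sharp_word n w = rev (map (\<lambda>i. n + 1 - i) w)"

definition baxt_sharp :: "nat \<Rightarrow> nat list set \<Rightarrow> nat list set" where
  "baxt_sharp n X = (\<Union>x\<in>X. baxt_class n (sharp_word n x))"

definition UT :: "nat \<Rightarrow> 'a::comm_semiring_1 mat monoid" where
  "UT m = \<lparr>carrier = {A \<in> carrier_mat m m. upper_triangular A}, mult = (*), one = 1\<^sub>m m\<rparr>"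

text \<open>Matrix indices start at 0 here, so that the index \<open>m + 1 - i\<close> of the usual
  definition becomes \<open>m - 1 - i\<close>.\<close>

definition skew_transpose :: "'a mat \<Rightarrow> 'a mat" where
  "skew_transpose A = mat (dim_col A) (dim_row A)
     (\<lambda>(i, j). A $$ (dim_row A - 1 - j, dim_col A - 1 - i))"

definition matP :: "'a::comm_semiring_1 \<Rightarrow> 'a mat" where
  "matP s = mat_of_rows_list 2 [[s, 0], [0, 1]]"

definition matQ :: "'a::comm_semiring_1 \<Rightarrow> 'a mat" where
  "matQ s = mat_of_rows_list 2 [[1, 0], [0, s]]"

definition matJ :: "'a::comm_semiring_1 mat" where
  "matJ = mat_of_rows_list 2 [[1, 1], [0, 0]]"

definition matK :: "'a::comm_semiring_1 mat" where
  "matK = mat_of_rows_list 2 [[0, 1], [0, 1]]"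

abbreviation mat1x1 :: "'a \<Rightarrow> 'a mat" where
  "mat1x1 a \<equiv> mat_of_rows_list 1 [[a]]"

text \<open>Letters other than 1 and 2 do not occur in words over the two-letter alphabet.\<close>

definition phi2_letter :: "'a::comm_semiring_1 \<Rightarrow> nat \<Rightarrow> 'a mat" where
  "phi2_letter s i =
     (if i = 1 then diag_block_mat [mat1x1 s, matP s, matJ, mat1x1 1]
      else diag_block_mat [mat1x1 1, matK, matQ s, mat1x1 s])"

primrec phi2 :: "'a::comm_semiring_1 \<Rightarrow> nat list \<Rightarrow> 'a mat" where
  "phi2 s [] = 1\<^sub>m 6"
| "phi2 s (i # w) = phi2_letter s i * phi2 s w"

end

theory Submission
  imports Defs
begin

text \<open>Over two letters the only Baxter relation is 2u12v1 = 2u21v1, so in a word of the form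
  1...1 2m1 2...2 the letters of m commute. The class of a word is therefore determined by its
  content together with the lengths of its maximal prefix of 1s and its maximal suffix of 2s.
  Since KX = K for every product X of copies of P and K, and XJ = J for every product X of copies
  of Q and J, the blocks of the representation record exactly these four numbers as exponents
  of s.\<close>

section \<open>The Baxter monoid with its involution\<close>

lemma baxt_cong_in_lists:
  "(x, y) \<in> baxt_cong n \<Longrightarrow> x \<in> lists {1..n} \<and> y \<in> lists {1..n}"
  by (induction rule: baxt_cong.induct) auto

lemma equiv_baxt_cong: "equiv (lists {1..n}) (baxt_cong n)"
proof (rule equivI)
  show "baxt_cong n \<subseteq> lists {1..n} \<times> lists {1..n}"
    using baxt_cong_in_lists by fast
  show "refl_on (lists {1..n}) (baxt_cong n)"
    by (auto intro!: refl_onI baxt_cong.refl)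
  show "sym (baxt_cong n)" by (rule symI) (rule baxt_cong.sym)
  show "trans (baxt_cong n)" by (rule transI) (rule baxt_cong.trans)
qed

lemma baxt_class_eq_iff:
  assumes "x \<in> lists {1..n}" "y \<in> lists {1..n}"
  shows "baxt_class n x = baxt_class n y \<longleftrightarrow> (x, y) \<in> baxt_cong n"
  unfolding baxt_class_def using eq_equiv_class_iff[OF equiv_baxt_cong assms] .

lemma mem_baxt_class: "y \<in> baxt_class n x \<longleftrightarrow> (x, y) \<in> baxt_cong n"
  by (simp add: baxt_class_def)

lemma baxt_class_self: "x \<in> lists {1..n} \<Longrightarrow> x \<in> baxt_class n x"
  unfolding mem_baxt_class by (rule baxt_cong.refl)

lemma carrier_baxt: "carrier (baxt n) = baxt_class n ` lists {1..n}"
  by (auto simp: baxt_def quotient_def baxt_class_def)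

lemma carrier_baxtE:
  assumes "X \<in> carrier (baxt n)"
  obtains x where "x \<in> lists {1..n}" "X = baxt_class n x"
  using assms unfolding carrier_baxt by blast

text \<open>Product and involution on \<open>baxt n\<close> are unions over all representatives;
  such a union collapses once its terms do not depend on the representative, as \<open>x\<close>
  itself makes the index set nonempty.\<close>

lemma UN_baxt_class:
  assumes "x \<in> lists {1..n}"
    and "\<And>x'. (x, x') \<in> baxt_cong n \<Longrightarrow> f x' = A"
  shows "(\<Union>x'\<in>baxt_class n x. f x') = A"
proof -
  have "f ` baxt_class n x = {A}"
    using assms(2) baxt_class_self[OF assms(1)]
    by (force simp: mem_baxt_class)
  then show ?thesis by simp
qed

lemma mult_baxt_class:
  assumes "x \<in> lists {1..n}" "y \<in> lists {1..n}"
  shows "baxt_class n x \<otimes>\<^bsub>baxt n\<^esub> baxt_class n y = baxt_class n (x @ y)"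
proof -
  have "baxt_class n (x' @ y') = baxt_class n (x @ y)"
    if "(x, x') \<in> baxt_cong n" "(y, y') \<in> baxt_cong n" for x' y'
    using baxt_cong.mult[OF that, THEN baxt_cong.sym]
      baxt_cong_in_lists[OF baxt_cong.mult[OF that]] baxt_class_eq_iff by blast
  then show ?thesis
    unfolding baxt_def monoid.simps by (intro UN_baxt_class assms)
qed

lemma one_baxt: "\<one>\<^bsub>baxt n\<^esub> = baxt_class n []"
  by (simp add: baxt_def)

lemma monoid_baxt: "monoid (baxt n)"
  by (rule monoidI)
    (auto simp: carrier_baxt one_baxt mult_baxt_class simp del: One_nat_def
      del: in_listsD in_listsI)

section \<open>Schuetzenberger's involution on words and classes\<close>

lemma sharp_word_in_lists: "w \<in> lists {1..n} \<Longrightarrow> sharp_word n w \<in> lists {1..n}"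
  by (fastforce simp: sharp_word_def)

lemma sharp_word_append: "sharp_word n (x @ y) = sharp_word n y @ sharp_word n x"
  by (simp add: sharp_word_def)

text \<open>Subtraction of naturals is truncated; on letters from \<open>{1..n}\<close> it is exact,
  so \<open>n + 1 - i\<close> undoes itself.\<close>

lemma sharp_word_sharp_word:
  assumes "w \<in> lists {1..n}"
  shows "sharp_word n (sharp_word n w) = w"
proof -
  have "map (\<lambda>i. n + 1 - (n + 1 - i)) w = w"
    using assms by (intro map_idI) auto
  then show ?thesis by (simp add: sharp_word_def rev_map o_def)
qed

text \<open>Each of the two families is mapped to itself: reversing order and word exchanges the
  roles of \<open>a\<close> with \<open>d\<close>, of \<open>b\<close> with \<open>c\<close>, and of
  \<open>u\<close> with \<open>v\<close>. The bound on the letters keeps strict inequalities strict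
  under truncated subtraction.\<close>

lemma sharp_word_baxt_relations:
  assumes "(x, y) \<in> baxt_relations" "x \<in> lists {1..n}"
  shows "(sharp_word n x, sharp_word n y) \<in> baxt_relations"
  using assms
proof (cases rule: baxt_relations.cases)
  case (1 a b c d u v)
  have "n + 1 - d \<le> n + 1 - c" "n + 1 - c < n + 1 - b" "n + 1 - b \<le> n + 1 - a"
    using 1 assms(2) by auto
  from baxt_relations.intros(1)[OF this, of "sharp_word n v" "sharp_word n u"]
  show ?thesis using 1 by (simp add: sharp_word_def)
next
  case (2 a b c d u v)
  have "n + 1 - d < n + 1 - c" "n + 1 - c \<le> n + 1 - b" "n + 1 - b < n + 1 - a"
    using 2 assms(2) by auto
  from baxt_relations.intros(2)[OF this, of "sharp_word n v" "sharp_word n u"]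
  show ?thesis using 2 by (simp add: sharp_word_def)
qed

lemma sharp_word_baxt_cong:
  "(x, y) \<in> baxt_cong n \<Longrightarrow> (sharp_word n x, sharp_word n y) \<in> baxt_cong n"
proof (induction rule: baxt_cong.induct)
  case (gen x y)
  then show ?case by (intro baxt_cong.gen sharp_word_baxt_relations sharp_word_in_lists)
next
  case (mult x x' y y')
  then show ?case by (simp add: sharp_word_append baxt_cong.mult)
next
  case (trans x y z)
  then show ?case using baxt_cong.trans by metis
next
  case (refl x)
  then show ?case by (intro baxt_cong.refl sharp_word_in_lists)
qed (rule baxt_cong.sym)

lemma baxt_sharp_baxt_class:
  assumes "x \<in> lists {1..n}"
  shows "baxt_sharp n (baxt_class n x) = baxt_class n (sharp_word n x)"
  unfolding baxt_sharp_def
proof (rule UN_baxt_class[OF assms])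
  fix x' assume "(x, x') \<in> baxt_cong n"
  from baxt_cong.sym[OF sharp_word_baxt_cong[OF this]]
  show "baxt_class n (sharp_word n x') = baxt_class n (sharp_word n x)"
    using baxt_class_eq_iff baxt_cong_in_lists by blast
qed

lemma involution_monoid_baxt: "involution_monoid (baxt n) (baxt_sharp n)"
proof -
  interpret monoid "baxt n" by (rule monoid_baxt)
  show ?thesis
  proof
    fix X assume "X \<in> carrier (baxt n)"
    then obtain x where x: "x \<in> lists {1..n}" "X = baxt_class n x"
      by (rule carrier_baxtE)
    show "baxt_sharp n X \<in> carrier (baxt n)"
      unfolding carrier_baxt x(2) baxt_sharp_baxt_class[OF x(1)]
      using sharp_word_in_lists[OF x(1)] by (rule imageI)
    show "baxt_sharp n (baxt_sharp n X) = X"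
      using x(1) by (simp add: x(2) baxt_sharp_baxt_class sharp_word_in_lists
          sharp_word_sharp_word del: One_nat_def)
    fix Y assume "Y \<in> carrier (baxt n)"
    then obtain y where y: "y \<in> lists {1..n}" "Y = baxt_class n y"
      by (rule carrier_baxtE)
    show "baxt_sharp n (X \<otimes>\<^bsub>baxt n\<^esub> Y) = baxt_sharp n Y \<otimes>\<^bsub>baxt n\<^esub> baxt_sharp n X"
      using x(1) y(1) by (simp add: x(2) y(2) mult_baxt_class baxt_sharp_baxt_class
          sharp_word_in_lists sharp_word_append del: One_nat_def)
  qed
qed

section \<open>Upper triangular matrices with skew transposition\<close>

text \<open>For \<open>j < i\<close> every \<open>k\<close> satisfies \<open>k < i\<close> or
  \<open>j < k\<close>, so each summand of the entry has a factor below a diagonal.\<close>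

lemma upper_triangular_mult:
  fixes A B :: "'a::semiring_0 mat"
  assumes A: "A \<in> carrier_mat n n" "upper_triangular A"
    and B: "B \<in> carrier_mat n n" "upper_triangular B"
  shows "upper_triangular (A * B)"
proof (rule upper_triangularI)
  fix i j assume ij: "j < i" "i < dim_row (A * B)"
  have "A $$ (i, k) * B $$ (k, j) = 0" if "k < n" for k
    using that ij A B upper_triangularD[OF A(2), of k i] upper_triangularD[OF B(2), of j k]
    by (cases "k < i") auto
  then show "(A * B) $$ (i, j) = 0"
    using ij A(1) B(1) by (auto simp: scalar_prod_def intro!: sum.neutral)
qed

lemma monoid_UT: "monoid (UT n :: 'a::comm_semiring_1 mat monoid)"
  by (rule monoidI) (auto simp: UT_def upper_triangular_mult)

section \<open>Skew transposition as an involution\<close>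

lemma skew_transpose_carrier:
  "A \<in> carrier_mat m n \<Longrightarrow> skew_transpose A \<in> carrier_mat n m"
  by (auto simp: skew_transpose_def)

lemma skew_transpose_skew_transpose: "skew_transpose (skew_transpose A) = A"
  by (rule eq_matI) (auto simp: skew_transpose_def)

lemma skew_transpose_mult:
  fixes A B :: "'a::comm_semiring_0 mat"
  assumes A: "A \<in> carrier_mat m n" and B: "B \<in> carrier_mat n k"
  shows "skew_transpose (A * B) = skew_transpose B * skew_transpose A"
proof (rule eq_matI)
  fix i j assume "i < dim_row (skew_transpose B * skew_transpose A)"
    "j < dim_col (skew_transpose B * skew_transpose A)"
  then have ij: "i < k" "j < m"
    using A B by (auto simp: skew_transpose_def)
  have "skew_transpose (A * B) $$ (i, j) =
      (\<Sum>l<n. A $$ (m - 1 - j, l) * B $$ (l, k - 1 - i))"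
    using ij A B by (simp add: skew_transpose_def scalar_prod_def atLeast0LessThan)
  \<comment> \<open>Skew transposition also reverses the inner index, hence the reindexing of the
    sum; commutativity of the entries then swaps the two factors.\<close>
  also have "\<dots> = (\<Sum>l<n. A $$ (m - 1 - j, n - Suc l) * B $$ (n - Suc l, k - 1 - i))"
    by (rule sum.nat_diff_reindex[symmetric])
  also have "\<dots> = (skew_transpose B * skew_transpose A) $$ (i, j)"
    using ij A B
    by (simp add: skew_transpose_def scalar_prod_def atLeast0LessThan mult.commute)
  finally show "skew_transpose (A * B) $$ (i, j) =
    (skew_transpose B * skew_transpose A) $$ (i, j)" .
qed (use A B in \<open>auto simp: skew_transpose_def\<close>)

lemma skew_transpose_one: "skew_transpose (1\<^sub>m n) = 1\<^sub>m n"
  by (rule eq_matI) (auto simp: skew_transpose_def)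

lemma upper_triangular_skew_transpose:
  assumes "A \<in> carrier_mat n n" "upper_triangular A"
  shows "upper_triangular (skew_transpose A)"
  using assms by (intro upper_triangularI) (auto simp: skew_transpose_def)

lemma involution_monoid_UT:
  "involution_monoid (UT n :: 'a::comm_semiring_1 mat monoid) skew_transpose"
proof -
  interpret monoid "UT n :: 'a mat monoid" by (rule monoid_UT)
  show ?thesis
    by standard (auto simp: UT_def skew_transpose_carrier upper_triangular_skew_transpose
        skew_transpose_skew_transpose intro: skew_transpose_mult)
qed

section \<open>Words over two letters\<close>

definition ones_prefix :: "nat list \<Rightarrow> nat" where
  "ones_prefix w = length (takeWhile ((=) 1) w)"

definition twos_suffix :: "nat list \<Rightarrow> nat" where
  "twos_suffix w = length (takeWhile ((=) 2) (rev w))"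

definition baxt2_invariants :: "nat list \<Rightarrow> nat \<times> nat \<times> nat \<times> nat" where
  "baxt2_invariants w = (count_list w 1, count_list w 2, ones_prefix w, twos_suffix w)"

text \<open>In \<open>{1..2}\<close> the chain a \<le> b < c \<le> d forces a = b = 1 and c = d = 2,
  whereas a < b \<le> c < d requires three different letters, so the second family is empty.\<close>

lemma baxt2_relations:
  assumes "(x, y) \<in> baxt_relations" "x \<in> lists {1..2}"
  obtains u v where "x = [2] @ u @ [1, 2] @ v @ [1]" "y = [2] @ u @ [2, 1] @ v @ [1]"
  using assms
proof (cases rule: baxt_relations.cases)
  case (1 a b c d u v)
  then have "a = 1" "b = 1" "c = 2" "d = 2"
    using assms(2) by auto
  with 1 that show ?thesis by simp
qed auto

text \<open>Both sides start with 2 and end with 1, so the prefix of 1s and the suffix of 2s are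
  empty, and the swap preserves the content.\<close>

lemma baxt2_invariants_relations:
  assumes "(x, y) \<in> baxt_relations" "x \<in> lists {1..2}"
  shows "baxt2_invariants x = baxt2_invariants y"
proof -
  obtain u v where "x = [2] @ u @ [1, 2] @ v @ [1]" "y = [2] @ u @ [2, 1] @ v @ [1]"
    using assms by (rule baxt2_relations)
  then show ?thesis
    by (simp add: baxt2_invariants_def ones_prefix_def twos_suffix_def)
qed

section \<open>Sorting words modulo the congruence\<close>

lemma baxt2_swap:
  assumes "u \<in> lists {1..2}" "v \<in> lists {1..2}"
  shows "([2] @ u @ [2, 1] @ v @ [1], [2] @ u @ [1, 2] @ v @ [1]) \<in> baxt_cong 2"
  by (rule baxt_cong.sym, rule baxt_cong.gen, rule baxt_relations.intros(1))
    (use assms in auto)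

lemma baxt2_shift:
  assumes "u \<in> lists {1..2}" "v \<in> lists {1..2}"
  shows "([2] @ u @ [2] @ replicate i 1 @ v @ [1], [2] @ u @ replicate i 1 @ [2] @ v @ [1])
    \<in> baxt_cong 2"
  using assms
proof (induction i arbitrary: u)
  case 0
  then show ?case by (auto intro!: baxt_cong.refl)
next
  case (Suc i)
  have swap: "([2] @ u @ [2, 1] @ (replicate i 1 @ v) @ [1], [2] @ u @ [1, 2] @ (replicate i 1 @ v) @ [1])
      \<in> baxt_cong 2"
    using Suc.prems by (intro baxt2_swap) auto
  \<comment> \<open>The 1 just passed is absorbed into the left context, which is why the induction
    generalises over \<open>u\<close>.\<close>
  have "([2] @ u @ [1, 2] @ (replicate i 1 @ v) @ [1],
      [2] @ (u @ [1]) @ replicate i 1 @ [2] @ v @ [1]) \<in> baxt_cong 2"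
    using Suc.IH[of "u @ [1]"] Suc.prems by simp
  from baxt_cong.trans[OF swap this] show ?case by simp
qed

text \<open>Insertion sort: with the head \<open>x\<close> moved into the context \<open>u\<close>,
  the tail is sorted first; a head 1 is then in place, and a head 2 is shifted past the block of
  1s.\<close>

lemma baxt2_sort:
  assumes "u \<in> lists {1..2}" "m \<in> lists {1..2}"
  shows "([2] @ u @ m @ [1],
      [2] @ u @ replicate (count_list m 1) 1 @ replicate (count_list m 2) 2 @ [1]) \<in> baxt_cong 2"
  using assms
proof (induction m arbitrary: u)
  case Nil
  then show ?case by (auto intro!: baxt_cong.refl)
next
  case (Cons x m)
  let ?i = "count_list m 1" and ?j = "count_list m 2"
  have IH: "([2] @ u @ [x] @ m @ [1], [2] @ u @ [x] @ replicate ?i 1 @ replicate ?j 2 @ [1])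
      \<in> baxt_cong 2"
    using Cons.IH[of "u @ [x]"] Cons.prems by simp
  have "x = 1 \<or> x = 2" using Cons.prems by auto
  then show ?case
  proof
    assume "x = 1"
    then show ?thesis using IH by simp
  next
    assume x: "x = 2"
    have "([2] @ u @ [2] @ replicate ?i 1 @ replicate ?j 2 @ [1],
        [2] @ u @ replicate ?i 1 @ [2] @ replicate ?j 2 @ [1]) \<in> baxt_cong 2"
      using Cons.prems by (intro baxt2_shift) auto
    from baxt_cong.trans[OF IH[unfolded x] this] show ?thesis using x by simp
  qed
qed

text \<open>The case p = a covers exactly the words without a 2 before a 1.\<close>

fun baxt2_normal_form :: "nat \<times> nat \<times> nat \<times> nat \<Rightarrow> nat list" where
  "baxt2_normal_form (a, b, p, q) =
    (if p = a then replicate a 1 @ replicate b 2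
     else replicate p 1 @ ([2] @ replicate (a - p - 1) 1 @ replicate (b - q - 1) 2 @ [1])
       @ replicate q 2)"

lemma takeWhile_replicate_append:
  "a \<noteq> x \<Longrightarrow> takeWhile ((=) a) (replicate k a @ x # ys) = replicate k a"
  by (induction k) auto

lemma two_letters_cases: "w \<in> lists {1..2} \<Longrightarrow> x \<in> set w \<Longrightarrow> x = 1 \<or> x = (2::nat)"
  by fastforce

lemma no_ones_replicate:
  assumes "w \<in> lists {1..2}" "1 \<notin> set w"
  obtains k where "w = replicate k (2::nat)"
  using replicate_eqI[OF HOL.refl, of w 2] two_letters_cases[OF assms(1)] assms(2) that by metis

lemma count_list_replicate: "count_list (replicate n x) y = (if x = y then n else 0)"
  by (induction n) auto

text \<open>After the maximal prefix of 1s is removed, the rest either consists of 2s, and the word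
  is its own normal form, or starts with 2 and contains a 1. In the latter case the factor between
  this first 2 and the last 1 is sorted.\<close>

lemma baxt_cong_baxt2_normal_form:
  assumes w: "w \<in> lists {1..2}"
  shows "(w, baxt2_normal_form (baxt2_invariants w)) \<in> baxt_cong 2"
proof -
  have replicate_refl: "(replicate i c, replicate i c) \<in> baxt_cong 2" if "c \<in> {1..2}" for i c
    by (rule baxt_cong.refl) (use that in auto)
  define p where "p = ones_prefix w"
  define r where "r = dropWhile ((=) 1) w"
  have "takeWhile ((=) 1) w = replicate p 1"
    unfolding p_def ones_prefix_def by (rule replicate_eqI) (auto dest: set_takeWhileD)
  then have w_eq: "w = replicate p 1 @ r"
    unfolding r_def by (metis takeWhile_dropWhile_id)
  then have r: "r \<in> lists {1..2}" using w by auto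
  show ?thesis
  proof (cases "1 \<in> set r")
    case False
    with r obtain k where "r = replicate k 2" by (rule no_ones_replicate)
    with w_eq have w_eq': "w = replicate p 1 @ replicate k 2" by simp
    have "count_list w 1 = p" "count_list w 2 = k"
      unfolding w_eq' by (simp_all add: count_list_replicate)
    then have "baxt2_invariants w = (p, k, p, twos_suffix w)"
      by (simp only: baxt2_invariants_def p_def)
    then have "baxt2_normal_form (baxt2_invariants w) = replicate p 1 @ replicate k 2"
      by simp
    then have "baxt2_normal_form (baxt2_invariants w) = w"
      by (simp only: w_eq'[symmetric])
    then show ?thesis using w by (simp add: baxt_cong.refl del: One_nat_def)
  next
    case True
    then obtain m t where mt: "r = m @ 1 # t" "1 \<notin> set t"
      using split_list_last by metis
    have "r \<noteq> []" using mt(1) by simp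
    then have "1 \<noteq> hd r" unfolding r_def by (rule hd_dropWhile)
    moreover have "m \<in> lists {1..2}" "t \<in> lists {1..2}" using r mt(1) by simp_all
    \<comment> \<open>An empty \<open>m\<close> would make \<open>r\<close> start with 1.\<close>
    ultimately obtain m' where m': "m = 2 # m'"
      using mt(1) two_letters_cases[of m] by (cases m) auto
    obtain k where k: "t = replicate k 2"
      using \<open>t \<in> lists {1..2}\<close> mt(2) by (rule no_ones_replicate)
    \<comment> \<open>The empty word is the context \<open>u\<close> of
      \<open>baxt2_sort\<close>.\<close>
    have weq: "w = replicate p 1 @ ([2] @ [] @ m' @ [1]) @ replicate k 2"
      using w_eq unfolding mt(1) m' k by simp
    have "count_list w 1 = p + count_list m' 1 + 1" "count_list w 2 = count_list m' 2 + 1 + k"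
      "twos_suffix w = k"
      unfolding weq
      by (simp_all add: count_list_replicate twos_suffix_def takeWhile_replicate_append)
    \<comment> \<open>The first component exceeds \<open>p\<close>, which selects the second branch
      of the normal form. The two summands 1 are the final 1 and the leading 2 around
      \<open>m'\<close>; the subtractions of 1 there cancel them.\<close>
    then have inv: "baxt2_invariants w =
        (p + count_list m' 1 + 1, count_list m' 2 + 1 + k, p, k)"
      by (simp only: baxt2_invariants_def p_def)
    have m'_lists: "m' \<in> lists {1..2}" using \<open>m \<in> lists {1..2}\<close> m' by simp
    have sorted: "([2] @ [] @ m' @ [1], [2] @ [] @ replicate (count_list m' 1) 1 @
        replicate (count_list m' 2) 2 @ [1]) \<in> baxt_cong 2"
      by (rule baxt2_sort[OF _ m'_lists]) simp
    have "(w, replicate p 1 @ ([2] @ [] @ replicate (count_list m' 1) 1 @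
        replicate (count_list m' 2) 2 @ [1]) @ replicate k 2) \<in> baxt_cong 2"
      unfolding weq by (intro baxt_cong.mult[OF replicate_refl baxt_cong.mult[OF sorted replicate_refl]])
        simp_all
    then show ?thesis by (simp add: inv)
  qed
qed

lemma baxt_cong_if_invariants_eq:
  assumes "x \<in> lists {1..2}" "y \<in> lists {1..2}" "baxt2_invariants x = baxt2_invariants y"
  shows "(x, y) \<in> baxt_cong 2"
  using assms baxt_cong_baxt2_normal_form[of x] baxt_cong_baxt2_normal_form[of y]
  by (metis baxt_cong.sym baxt_cong.trans)

section \<open>The representation\<close>

text \<open>A triple (a, b, c) encodes the 2 x 2 block with rows a, b and 0, c. The explicit table
  lets entries and products be evaluated without nested block matrices.\<close>

definition blocks :: "'a \<Rightarrow> 'a \<times> 'a \<times> 'a \<Rightarrow> 'a \<times> 'a \<times> 'a \<Rightarrow> 'a \<Rightarrow> 'a::comm_semiring_1 mat" where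
  "blocks x B C y = (case (B, C) of ((a, b, c), (d, e, f)) \<Rightarrow>
     mat 6 6 (\<lambda>(i, j).
      [[x, 0, 0, 0, 0, 0],
       [0, a, b, 0, 0, 0],
       [0, 0, c, 0, 0, 0],
       [0, 0, 0, d, e, 0],
       [0, 0, 0, 0, f, 0],
       [0, 0, 0, 0, 0, y]] ! i ! j))"

lemma mat6_eqI:
  assumes "A \<in> carrier_mat 6 6" "B \<in> carrier_mat 6 6"
    and "\<forall>i\<in>{0, 1, 2, 3, 4, 5}. \<forall>j\<in>{0, 1, 2, 3, 4, 5}. A $$ (i, j) = B $$ (i, j)"
  shows "A = B"
proof (rule eq_matI)
  fix i j assume "i < dim_row B" "j < dim_col B"
  then have "i \<in> {0, 1, 2, 3, 4, 5}" "j \<in> {0, 1, 2, 3, 4, 5}"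
    using assms(2) by auto
  then show "A $$ (i, j) = B $$ (i, j)" using assms(3) by blast
qed (use assms in auto)

lemma sum_lessThan_6: "(\<Sum>k<6. f k) = f 0 + f 1 + f 2 + f 3 + f 4 + f (5::nat)"
  by (simp add: numeral_eq_Suc)

lemma blocks_carrier: "blocks x B C y \<in> carrier_mat 6 6"
  by (cases B; cases C) (simp add: blocks_def)

lemma blocks_index:
  assumes "i < 6" "j < 6"
  shows "blocks x (a, b, c) (d, e, f) y $$ (i, j) =
    [[x, 0, 0, 0, 0, 0],
     [0, a, b, 0, 0, 0],
     [0, 0, c, 0, 0, 0],
     [0, 0, 0, d, e, 0],
     [0, 0, 0, 0, f, 0],
     [0, 0, 0, 0, 0, y]] ! i ! j"
  using assms by (simp add: blocks_def)

lemma upper_triangular_blocks: "upper_triangular (blocks x B C y)"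
proof (rule upper_triangularI)
  fix i j assume ij: "j < i" "i < dim_row (blocks x B C y)"
  then have "i < 6" using blocks_carrier[of x B C y] by auto
  then have "i \<in> {0, 1, 2, 3, 4, 5}" "j \<in> {0, 1, 2, 3, 4, 5}" using ij(1) by auto
  moreover have "\<forall>i\<in>{0, 1, 2, 3, 4, 5}. \<forall>j\<in>{0, 1, 2, 3, 4, 5}. j < i \<longrightarrow> blocks x B C y $$ (i, j) = 0"
    by (cases B; cases C) (simp add: blocks_index)
  ultimately show "blocks x B C y $$ (i, j) = 0" using ij(1) by blast
qed

lemma blocks_mult:
  "blocks x (a, b, c) (d, e, f) y * blocks x' (a', b', c') (d', e', f') y' =
   blocks (x * x') (a * a', a * b' + b * c', c * c') (d * d', d * e' + e * f', f * f') (y * y')"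
  (is "?A * ?B = ?C")
proof (rule mat6_eqI)
  have "(?A * ?B) $$ (i, j) = (\<Sum>k<6. ?A $$ (i, k) * ?B $$ (k, j))" if "i < 6" "j < 6" for i j
    using that blocks_carrier[of x "(a, b, c)" "(d, e, f)" y]
      blocks_carrier[of x' "(a', b', c')" "(d', e', f')" y']
    by (simp add: scalar_prod_def atLeast0LessThan)
  then show "\<forall>i\<in>{0, 1, 2, 3, 4, 5}. \<forall>j\<in>{0, 1, 2, 3, 4, 5}. (?A * ?B) $$ (i, j) = ?C $$ (i, j)"
    by (simp add: sum_lessThan_6 blocks_index)
qed (auto intro: blocks_carrier mult_carrier_mat)

lemma one_blocks: "1\<^sub>m 6 = blocks 1 (1, 0, 1) (1, 0, 1) 1"
  by (rule mat6_eqI) (simp_all add: blocks_index blocks_carrier)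

lemma diag_block_mat_blocks:
  "diag_block_mat [mat1x1 x, mat_of_rows_list 2 [[a, b], [0, c]],
     mat_of_rows_list 2 [[d, e], [0, f]], mat1x1 y] = blocks x (a, b, c) (d, e, f) y"
proof -
  let ?B = "mat_of_rows_list 2 [[a, b], [0, c]]" and ?C = "mat_of_rows_list 2 [[d, e], [0, f]]"
  \<comment> \<open>\<open>diag_block_mat\<close> recurses on the tail of its list, so the matrix is
    assembled from the lower right corner, with sizes 3, 5 and 6.\<close>
  have "diag_block_mat [?C, mat1x1 y] =
      mat 3 3 (\<lambda>(i, j). [[d, e, 0], [0, f, 0], [0, 0, y]] ! i ! j)"
    by (rule eq_matI)
      (auto simp: mat_of_rows_list_def four_block_mat_def Let_def less_Suc_eq numeral_3_eq_3)
  then have "diag_block_mat [?B, ?C, mat1x1 y] = mat 5 5 (\<lambda>(i, j).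
      [[a, b, 0, 0, 0],
       [0, c, 0, 0, 0],
       [0, 0, d, e, 0],
       [0, 0, 0, f, 0],
       [0, 0, 0, 0, y]] ! i ! j)"
    unfolding diag_block_mat.simps(2)[of ?B] Let_def
    by (intro eq_matI)
      (auto simp: mat_of_rows_list_def four_block_mat_def Let_def less_Suc_eq numeral_eq_Suc)
  then show ?thesis
    unfolding diag_block_mat.simps(2)[of "mat1x1 x"] Let_def
    by (intro eq_matI)
      (auto simp: blocks_def mat_of_rows_list_def four_block_mat_def Let_def less_Suc_eq
        numeral_eq_Suc)
qed

section \<open>Closed form of the representation on words\<close>

lemma phi2_letter_blocks:
  "phi2_letter s i = (if i = 1 then blocks s (s, 0, 1) (1, 1, 0) 1
    else blocks 1 (0, 1, 1) (1, 0, s) s)"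
  unfolding phi2_letter_def matP_def matQ_def matJ_def matK_def diag_block_mat_blocks ..

lemma ones_prefix_Cons: "ones_prefix (x # w) = (if x = 1 then Suc (ones_prefix w) else 0)"
  by (auto simp: ones_prefix_def)

text \<open>A 1 in \<open>w\<close> stops the suffix before it can reach \<open>x\<close>; otherwise
  \<open>w\<close> consists of 2s and the suffix is all of \<open>w\<close>, extended by
  \<open>x\<close> if that is a 2.\<close>

lemma twos_suffix_Cons:
  assumes "w \<in> lists {1..2}"
  shows "twos_suffix (x # w) =
    (if 1 \<in> set w then twos_suffix w else if x = 2 then Suc (count_list w 2) else count_list w 2)"
proof (cases "1 \<in> set w")
  case True
  then show ?thesis by (simp add: twos_suffix_def)
next
  case False
  with assms obtain k where "w = replicate k 2" by (rule no_ones_replicate)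
  then show ?thesis
    by (auto simp: twos_suffix_def takeWhile_replicate_append count_list_replicate
      replicate_append_same)
qed

text \<open>The induction multiplies by letters from the left. In the first block a 2 resets the
  off-diagonal power of \<open>s\<close> to exponent 0 and each further 1 raises it, so it counts
  the 1s before the first 2. In the second block the last 1 turns the power collected from the 2s
  after it into the off-diagonal entry, and letters further left leave that entry fixed. Words
  missing a letter give plain powers of P or of Q.\<close>

lemma phi2_blocks:
  assumes "w \<in> lists {1..2}"
  shows "phi2 s w = blocks (s ^ count_list w 1)
    (if 2 \<in> set w then (0, s ^ ones_prefix w, 1) else (s ^ count_list w 1, 0, 1))
    (if 1 \<in> set w then (1, s ^ twos_suffix w, 0) else (1, 0, s ^ count_list w 2))
    (s ^ count_list w 2)"
  using assms
proof (induction w)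
  case Nil
  then show ?case by (simp add: one_blocks)
next
  case (Cons x w)
  then have "x = 1 \<or> x = 2" and w: "w \<in> lists {1..2}" by auto
  with Cons.IH show ?case
    by (auto simp: phi2_letter_blocks blocks_mult ones_prefix_Cons twos_suffix_Cons[OF w])
qed

section \<open>Multiplicativity and compatibility with the congruence\<close>

lemma phi2_carrier_UT: "w \<in> lists {1..2} \<Longrightarrow> phi2 s w \<in> carrier (UT 6)"
  by (simp add: phi2_blocks UT_def blocks_carrier upper_triangular_blocks del: One_nat_def)

lemma phi2_letter_carrier: "phi2_letter s i \<in> carrier_mat 6 6"
  by (simp add: phi2_letter_blocks blocks_carrier)

lemma phi2_carrier: "phi2 s w \<in> carrier_mat 6 6"
  by (induction w) (auto intro: mult_carrier_mat phi2_letter_carrier)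

lemma phi2_append: "phi2 s (x @ y) = phi2 s x * phi2 s y"
  by (induction x)
    (simp_all add: left_mult_one_mat[OF phi2_carrier]
      assoc_mult_mat[OF phi2_letter_carrier phi2_carrier phi2_carrier])

lemma phi2_eq_if_invariants_eq:
  assumes "x \<in> lists {1..2}" "y \<in> lists {1..2}" "baxt2_invariants x = baxt2_invariants y"
  shows "phi2 s x = phi2 s y"
proof -
  \<comment> \<open>The case distinctions in \<open>phi2_blocks\<close> depend on which letters
    occur, and a letter occurs iff its count is nonzero.\<close>
  have "c \<in> set x \<longleftrightarrow> c \<in> set y" if "c \<in> {1, 2}" for c
    using assms(3) that count_list_0_iff[of x c] count_list_0_iff[of y c]
    by (auto simp: baxt2_invariants_def)
  then show ?thesis
    using assms by (simp add: phi2_blocks baxt2_invariants_def del: One_nat_def)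
qed

lemma phi2_baxt_cong: "(x, y) \<in> baxt_cong 2 \<Longrightarrow> phi2 s x = phi2 s y"
proof (induction rule: baxt_cong.induct)
  case (gen x y)
  then show ?case using phi2_eq_if_invariants_eq baxt2_invariants_relations by blast
qed (simp_all add: phi2_append)

section \<open>Recovering the invariants from the matrix\<close>

lemma ones_prefix_eq_count: "w \<in> lists {1..2} \<Longrightarrow> 2 \<notin> set w \<Longrightarrow> ones_prefix w = count_list w 1"
  by (induction w) (auto simp: ones_prefix_def)

lemma twos_suffix_eq_count:
  "w \<in> lists {1..2} \<Longrightarrow> 1 \<notin> set w \<Longrightarrow> twos_suffix w = count_list w 2"
  by (erule no_ones_replicate) (simp_all add: twos_suffix_def count_list_replicate)

lemma invariants_eq_if_phi2_eq:
  fixes s :: "'a::comm_semiring_1"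
  assumes inf_order: "\<And>i j::nat. s ^ i = s ^ j \<longleftrightarrow> i = j"
    and x: "x \<in> lists {1..2}" and y: "y \<in> lists {1..2}"
    and eq: "phi2 s x = phi2 s y"
  shows "baxt2_invariants x = baxt2_invariants y"
proof -
  have entries: "phi2 s w $$ (0, 0) = s ^ count_list w 1"
    "phi2 s w $$ (5, 5) = s ^ count_list w 2"
    "2 \<in> set w \<Longrightarrow> phi2 s w $$ (1, 2) = s ^ ones_prefix w"
    "1 \<in> set w \<Longrightarrow> phi2 s w $$ (3, 4) = s ^ twos_suffix w"
    if "w \<in> lists {1..2}" for w
    unfolding phi2_blocks[OF that] by (simp_all add: blocks_index)
  have count: "count_list x 1 = count_list y 1" "count_list x 2 = count_list y 2"
    using entries(1,2)[OF x] entries(1,2)[OF y] eq inf_order by auto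
  have mem: "c \<in> set x \<longleftrightarrow> c \<in> set y" if "c \<in> {1, 2}" for c
    using count that count_list_0_iff[of x c] count_list_0_iff[of y c] by auto
  \<comment> \<open>Without a 2 the entry (1, 2) is 0 and carries no exponent; the prefix length is
    then the number of 1s. The suffix of 2s is treated symmetrically.\<close>
  have "ones_prefix x = ones_prefix y"
    using entries(3)[OF x] entries(3)[OF y] mem[of 2] eq inf_order count
      ones_prefix_eq_count[OF x] ones_prefix_eq_count[OF y]
    by (cases "2 \<in> set x") auto
  moreover have "twos_suffix x = twos_suffix y"
    using entries(4)[OF x] entries(4)[OF y] mem[of 1] eq inf_order count
      twos_suffix_eq_count[OF x] twos_suffix_eq_count[OF y]
    by (cases "1 \<in> set x") auto
  ultimately show ?thesis using count by (simp add: baxt2_invariants_def)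
qed

text \<open>Skew transposition reverses the order of the diagonal blocks and exchanges P with Q and
  J with K; \<open>3 - i\<close> is the image of the letter \<open>i\<close> under the involution
  for two letters.\<close>

lemma skew_transpose_phi2_letter:
  assumes "i \<in> {1..2}"
  shows "skew_transpose (phi2_letter s i) = phi2_letter s (3 - i)"
proof (rule mat6_eqI)
  have "i = 1 \<or> i = 2" using assms by auto
  moreover have "skew_transpose (phi2_letter s i) $$ (k, l) = phi2_letter s i $$ (5 - l, 5 - k)"
    if "k < 6" "l < 6" for k l
    using that phi2_letter_carrier[of s i] by (simp add: skew_transpose_def)
  ultimately show "\<forall>k\<in>{0, 1, 2, 3, 4, 5}. \<forall>l\<in>{0, 1, 2, 3, 4, 5}.
      skew_transpose (phi2_letter s i) $$ (k, l) = phi2_letter s (3 - i) $$ (k, l)"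
    by (auto simp: phi2_letter_blocks blocks_index)
qed (auto intro: skew_transpose_carrier phi2_letter_carrier)

text \<open>Both sides reverse products and agree on letters.\<close>

lemma phi2_sharp_word:
  "w \<in> lists {1..2} \<Longrightarrow> phi2 s (sharp_word 2 w) = skew_transpose (phi2 s w)"
proof (induction w)
  case Nil
  then show ?case by (simp add: sharp_word_def skew_transpose_one)
next
  case (Cons i w)
  \<comment> \<open>The factor \<open>1\<^sub>m 6\<close> is the value of \<open>phi2\<close> at the
    empty tail of the one-letter word \<open>[3 - i]\<close>.\<close>
  have "phi2 s (sharp_word 2 (i # w)) = phi2 s (sharp_word 2 w) * (phi2_letter s (3 - i) * 1\<^sub>m 6)"
    by (simp add: sharp_word_def phi2_append)
  also have "\<dots> = skew_transpose (phi2 s w) * skew_transpose (phi2_letter s i)"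
    using Cons
    by (simp add: skew_transpose_phi2_letter right_mult_one_mat[OF phi2_letter_carrier])
  also have "\<dots> = skew_transpose (phi2 s (i # w))"
    by (simp add: skew_transpose_mult[OF phi2_letter_carrier phi2_carrier])
  finally show ?case .
qed

theorem theorem3p1:
  fixes s :: "'a::comm_semiring_1"
  assumes idem: "\<And>a::'a. a + a = a"
    and inf_order: "\<And>i j::nat. s ^ i = s ^ j \<longleftrightarrow> i = j"
  shows "phi2 s \<in> hom (free_monoid 2) (UT 6) \<and>
    (\<exists>\<phi>. (\<forall>w\<in>lists {1..2}. \<phi> (baxt_class 2 w) = phi2 s w) \<and>
         involution_monoid_hom (baxt 2) (baxt_sharp 2) (UT 6) skew_transpose \<phi> \<and>
         inj_on \<phi> (carrier (baxt 2)))"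
proof (intro conjI exI)
  \<comment> \<open>Since \<open>phi2\<close> is constant on each class, the image of a class is a
    singleton, and its element is the induced value.\<close>
  let ?\<phi> = "\<lambda>X. the_elem (phi2 s ` X)"
  show "phi2 s \<in> hom (free_monoid 2) (UT 6)"
  proof (rule homI)
    show "phi2 s w \<in> carrier (UT 6)" if "w \<in> carrier (free_monoid 2)" for w
      using that unfolding free_monoid_def partial_object.simps by (rule phi2_carrier_UT)
  qed (simp add: free_monoid_def UT_def phi2_append)
  have \<phi>: "?\<phi> (baxt_class 2 w) = phi2 s w" if "w \<in> lists {1..2}" for w
  proof -
    have "phi2 s x = phi2 s w" if "x \<in> baxt_class 2 w" for x
      using that phi2_baxt_cong unfolding mem_baxt_class by metis
    then have "phi2 s ` baxt_class 2 w = {phi2 s w}"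
      using baxt_class_self[OF that] by blast
    then show ?thesis by simp
  qed
  then show "\<forall>w\<in>lists {1..2}. ?\<phi> (baxt_class 2 w) = phi2 s w" by blast
  interpret M: involution_monoid "baxt 2" "baxt_sharp 2" by (rule involution_monoid_baxt)
  interpret N: involution_monoid "UT 6 :: 'a mat monoid" skew_transpose
    by (rule involution_monoid_UT)
  show "involution_monoid_hom (baxt 2) (baxt_sharp 2) (UT 6) skew_transpose ?\<phi>"
  proof
    show "?\<phi> \<in> hom (baxt 2) (UT 6)"
    proof (rule homI)
      fix X assume "X \<in> carrier (baxt 2)"
      then obtain x where x: "x \<in> lists {1..2}" "X = baxt_class 2 x"
        by (rule carrier_baxtE)
      show "?\<phi> X \<in> carrier (UT 6)"
        unfolding x(2) \<phi>[OF x(1)] by (rule phi2_carrier_UT[OF x(1)])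
      fix Y assume "Y \<in> carrier (baxt 2)"
      then obtain y where y: "y \<in> lists {1..2}" "Y = baxt_class 2 y"
        by (rule carrier_baxtE)
      have xy: "x @ y \<in> lists {1..2}" using x(1) y(1) by simp
      show "?\<phi> (X \<otimes>\<^bsub>baxt 2\<^esub> Y) = ?\<phi> X \<otimes>\<^bsub>UT 6\<^esub> ?\<phi> Y"
        unfolding x(2) y(2) mult_baxt_class[OF x(1) y(1)] \<phi>[OF x(1)] \<phi>[OF y(1)] \<phi>[OF xy]
        by (simp add: UT_def phi2_append)
    qed
    show "?\<phi> \<one>\<^bsub>baxt 2\<^esub> = \<one>\<^bsub>UT 6\<^esub>"
      using \<phi>[of "[]"] by (simp add: one_baxt UT_def)
    fix X assume "X \<in> carrier (baxt 2)"
    then obtain x where x: "x \<in> lists {1..2}" "X = baxt_class 2 x"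
      by (rule carrier_baxtE)
    show "?\<phi> (baxt_sharp 2 X) = skew_transpose (?\<phi> X)"
      unfolding x(2) baxt_sharp_baxt_class[OF x(1)] \<phi>[OF x(1)]
        \<phi>[OF sharp_word_in_lists[OF x(1)]] by (rule phi2_sharp_word[OF x(1)])
  qed
  show "inj_on ?\<phi> (carrier (baxt 2))"
  proof (rule inj_onI)
    fix X Y assume "X \<in> carrier (baxt 2)" "Y \<in> carrier (baxt 2)" and eq: "?\<phi> X = ?\<phi> Y"
    from \<open>X \<in> carrier (baxt 2)\<close> obtain x where x: "x \<in> lists {1..2}" "X = baxt_class 2 x"
      by (rule carrier_baxtE)
    from \<open>Y \<in> carrier (baxt 2)\<close> obtain y where y: "y \<in> lists {1..2}" "Y = baxt_class 2 y"
      by (rule carrier_baxtE)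
    have "phi2 s x = phi2 s y" using eq unfolding x(2) y(2) \<phi>[OF x(1)] \<phi>[OF y(1)] .
    \<comment> \<open>Infinite order of \<open>s\<close> makes equal matrices yield equal
      invariants, and these determine the class through the common normal form.\<close>
    then have "(x, y) \<in> baxt_cong 2"
      using invariants_eq_if_phi2_eq[OF inf_order x(1) y(1)]
        baxt_cong_if_invariants_eq[OF x(1) y(1)] by blast
    then show "X = Y" unfolding x(2) y(2) baxt_class_eq_iff[OF x(1) y(1)] .
  qed
qed

end
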